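(* Let $k \ge 3$ be an integer and let $G^O(k) = (C \cup (V\setminus C), E)$ be any graph with vertex set $V$ and $C\subseteq V$ such that $|C|=k$, the induced subgraph $G^O(k)[C]$ has no open twins, and $V\setminus C$ consists of exactly one vertex $v_{C'}$ with $N(v_{C'})\cap C=C'$ for each non-empty subset $C'\subseteq C$ such that there is no vertex $u\in C$ with $N(u)\cap C=C'$ (with no condition on the edges inside $V\setminus C$). Then in $G^O(k)$, the set $C$ is a minimum-cardinality (i) OD-code; (ii) OTD-code if $G^O(k)[C]$ has no isolated vertex, that is, if $G^O(k)[C]$ is OTD-admissible. Moreover, for $X \in \{\mathrm{OD}, \mathrm{OTD}\}$, the minimum X-density among all X-admissible graphs with X-number $k$ is attained by the graphs $G^O(k)$ for which $G^O(k)[C]$ has an isolated vertex if $X=\mathrm{OD}$, and by those graphs $G^O(k)$ for which $G^O(k)[C]$ has no isolated vertex if $X=\mathrm{OTD}$.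
   Context: Graphs are finite, simple and undirected. For a graph $G=(V,E)$ and $v\in V$, $N(v)$ is the open neighborhood and $N[v]=N(v)\cup\{v\}$ the closed neighborhood; $G[C]$ is the subgraph induced by $C$. Open twins are distinct non-adjacent vertices $u,v$ with $N(u)=N(v)$. A set $C\subseteq V$ is dominating (resp. total-dominating) if $N[v]\cap C\neq\emptyset$ (resp. $N(v)\cap C\ne\emptyset$) for all $v\in V$. A set $C$ is open-separating if $N(u)\cap C\neq N(v)\cap C$ for all distinct $u,v\in V$ (the set $N(v)\cap C$ may be empty for at most one vertex). An OD-code (resp. OTD-code) is a set that is open-separating and dominating (resp. total-dominating). A graph is X-admissible if it has an X-code; the X-number $\gamma^{X}(G)$ of an X-admissible graph is the minimum cardinality of an X-code of $G$. The X-density of an X-admissible graph $G$ on $n$ vertices is $\gamma^{X}(G)/n$. *)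

theory Defs
  imports Complex_Main "Graph_Theory.Digraph_Component"
begin

text \<open>
  Finite simple undirected graphs are the symmetric digraphs of the locale \<^locale>\<open>graph\<close>:
  finite, no loops, no parallel arcs. Each edge is a pair of opposite arcs.
\<close>

definition nbhd :: "('a,'b) pre_digraph \<Rightarrow> 'a \<Rightarrow> 'a set" where
  "nbhd G v = {u. v \<rightarrow>\<^bsub>G\<^esub> u}"

definition closed_nbhd :: "('a,'b) pre_digraph \<Rightarrow> 'a \<Rightarrow> 'a set" where
  "closed_nbhd G v = insert v (nbhd G v)"

definition open_twins :: "('a,'b) pre_digraph \<Rightarrow> 'a \<Rightarrow> 'a \<Rightarrow> bool" where
  "open_twins G u v \<longleftrightarrow> u \<in> verts G \<and> v \<in> verts G \<and> u \<noteq> v \<and>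
     \<not> u \<rightarrow>\<^bsub>G\<^esub> v \<and> nbhd G u = nbhd G v"

definition has_open_twins :: "('a,'b) pre_digraph \<Rightarrow> bool" where
  "has_open_twins G \<longleftrightarrow> (\<exists>u v. open_twins G u v)"

definition has_isolated_vertex :: "('a,'b) pre_digraph \<Rightarrow> bool" where
  "has_isolated_vertex G \<longleftrightarrow> (\<exists>v\<in>verts G. nbhd G v = {})"

definition dominating :: "('a,'b) pre_digraph \<Rightarrow> 'a set \<Rightarrow> bool" where
  "dominating G C \<longleftrightarrow> C \<subseteq> verts G \<and> (\<forall>v\<in>verts G. closed_nbhd G v \<inter> C \<noteq> {})"

definition total_dominating :: "('a,'b) pre_digraph \<Rightarrow> 'a set \<Rightarrow> bool" where
  "total_dominating G C \<longleftrightarrow> C \<subseteq> verts G \<and> (\<forall>v\<in>verts G. nbhd G v \<inter> C \<noteq> {})"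

definition open_separating :: "('a,'b) pre_digraph \<Rightarrow> 'a set \<Rightarrow> bool" where
  "open_separating G C \<longleftrightarrow> C \<subseteq> verts G \<and>
     (\<forall>u\<in>verts G. \<forall>v\<in>verts G. u \<noteq> v \<longrightarrow> nbhd G u \<inter> C \<noteq> nbhd G v \<inter> C)"

datatype code_kind = OD | OTD

fun is_code :: "code_kind \<Rightarrow> ('a,'b) pre_digraph \<Rightarrow> 'a set \<Rightarrow> bool" where
  "is_code OD G C \<longleftrightarrow> open_separating G C \<and> dominating G C"
| "is_code OTD G C \<longleftrightarrow> open_separating G C \<and> total_dominating G C"

definition admissible :: "code_kind \<Rightarrow> ('a,'b) pre_digraph \<Rightarrow> bool" where
  "admissible X G \<longleftrightarrow> (\<exists>C. is_code X G C)"

text \<open>Only meaningful for finite admissible graphs; otherwise \<^const>\<open>Min\<close> is unspecified.\<close>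
definition code_number :: "code_kind \<Rightarrow> ('a,'b) pre_digraph \<Rightarrow> nat" where
  "code_number X G = Min (card ` {C. is_code X G C})"

definition code_density :: "code_kind \<Rightarrow> ('a,'b) pre_digraph \<Rightarrow> real" where
  "code_density X G = real (code_number X G) / real (card (verts G))"

text \<open>
  \<open>GO k G C\<close>: the graph \<open>G\<close> with distinguished vertex set \<open>C\<close> is one of the graphs
  $G^O(k)$. The bijection says that every vertex outside \<open>C\<close> has as its trace on \<open>C\<close> a
  nonempty set not realised by a vertex of \<open>C\<close>, and that each such set is the trace of
  exactly one of them.
\<close>
definition GO :: "nat \<Rightarrow> ('a,'b) pre_digraph \<Rightarrow> 'a set \<Rightarrow> bool" where
  "GO k G C \<longleftrightarrow> graph G \<and> C \<subseteq> verts G \<and> card C = k \<and> \<not> has_open_twins (G \<restriction> C) \<and>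
     bij_betw (\<lambda>v. nbhd G v \<inter> C) (verts G - C)
       {C'. C' \<subseteq> C \<and> C' \<noteq> {} \<and> \<not> (\<exists>u\<in>C. nbhd G u \<inter> C = C')}"

end

theory Submission
  imports Defs "HOL-Library.Nat_Bijection"
begin

text \<open>
  An open-separating set \<open>C\<close> assigns to the vertices pairwise distinct traces on \<open>C\<close>, so a graph with
  such a set has at most $2^{|C|}$ vertices, and one less if \<open>C\<close> is total-dominating, since then no
  trace is empty. In $G^O(k)$ every nonempty subset of \<open>C\<close> is a trace, and the empty one is a trace
  exactly if the induced subgraph on \<open>C\<close> has an isolated vertex. These graphs therefore have
  $2^k$ or $2^k-1$ vertices, which attains both bounds; as $2^{k-1} < 2^k - 1$, no smaller
  code exists.
\<close>

section \<open>Neighborhoods, traces and code numbers\<close>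

lemma nbhd_subset_verts: "graph G \<Longrightarrow> nbhd G v \<subseteq> verts G"
proof -
  assume "graph G"
  then interpret graph G .
  show ?thesis by (auto simp: nbhd_def dest: adj_in_verts)
qed

lemma not_self_in_nbhd: "graph G \<Longrightarrow> v \<notin> nbhd G v"
proof -
  assume "graph G"
  then interpret graph G .
  show ?thesis by (auto simp: nbhd_def dest: adj_not_same)
qed

lemma nbhd_induce_subgraph: "v \<in> C \<Longrightarrow> nbhd (G \<restriction> C) v = nbhd G v \<inter> C"
  by (auto simp: nbhd_def arcs_ends_conv image_iff)

text \<open>Injectivity of the trace map is the form in which separation enters the counting
  arguments: the order of the graph is then its number of traces.\<close>

lemma open_separating_iff_inj_on:
  "open_separating G C \<longleftrightarrow> C \<subseteq> verts G \<and> inj_on (\<lambda>v. nbhd G v \<inter> C) (verts G)"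
  by (auto simp: open_separating_def inj_on_def)

lemma is_code_open_separating: "is_code X G C \<Longrightarrow> open_separating G C"
  by (cases X) auto

lemma is_code_subset_verts: "is_code X G C \<Longrightarrow> C \<subseteq> verts G"
  using is_code_open_separating by (auto simp: open_separating_def)

lemma finite_codes: "finite (verts G) \<Longrightarrow> finite {C. is_code X G C}"
  by (rule finite_subset[of _ "Pow (verts G)"]) (auto dest: is_code_subset_verts)

lemma code_number_attained:
  assumes "finite (verts G)" "admissible X G"
  obtains C where "is_code X G C" "card C = code_number X G"
proof -
  have "code_number X G \<in> card ` {C. is_code X G C}"
    unfolding code_number_def
    using assms by (intro Min_in) (auto simp: finite_codes admissible_def)
  then show thesis using that by auto
qed

lemma code_number_eqI:
  assumes "finite (verts G)" "is_arg_min card (is_code X G) C"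
  shows "code_number X G = card C"
  unfolding code_number_def
proof (rule Min_eqI)
  show "finite (card ` {C. is_code X G C})" using assms(1) by (simp add: finite_codes)
qed (use assms(2) in \<open>auto simp: is_arg_min_def not_less\<close>)

section \<open>Upper bounds on the order of a graph with a given code\<close>

lemma card_verts_le_power:
  assumes "finite (verts G)" "is_code X G C"
  shows "card (verts G) \<le> 2 ^ card C"
proof -
  have sub: "C \<subseteq> verts G" and inj: "inj_on (\<lambda>v. nbhd G v \<inter> C) (verts G)"
    using is_code_open_separating[OF assms(2)] by (auto simp: open_separating_iff_inj_on)
  have fin: "finite C" using sub assms(1) finite_subset by blast
  have "card (verts G) \<le> card (Pow C)"
    by (rule card_inj_on_le[OF inj]) (auto simp: fin)
  then show ?thesis using fin by (simp add: card_Pow)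
qed

lemma card_verts_le_power_minus_1:
  assumes "finite (verts G)" "is_code OTD G C"
  shows "card (verts G) \<le> 2 ^ card C - 1"
proof -
  have sub: "C \<subseteq> verts G" and inj: "inj_on (\<lambda>v. nbhd G v \<inter> C) (verts G)"
    using is_code_open_separating[OF assms(2)] by (auto simp: open_separating_iff_inj_on)
  have fin: "finite C" using sub assms(1) finite_subset by blast
  have "card (verts G) \<le> card (Pow C - {{}})"
    by (rule card_inj_on_le[OF inj]) (use assms(2) in \<open>auto simp: fin total_dominating_def\<close>)
  then show ?thesis using fin by (simp add: card_Diff_singleton card_Pow)
qed

section \<open>Traces in the graphs \<open>GO\<close>\<close>

lemma finite_verts_graph: "graph G \<Longrightarrow> finite (verts G)"
  by (simp add: graph_def digraph_def fin_digraph.finite_verts)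

text \<open>
  Vertices of \<open>C\<close> with equal traces are non-adjacent for want of loops, hence open twins
  in \<open>G \<restriction> C\<close>.
\<close>
lemma inj_on_trace_iff_no_open_twins:
  assumes "graph G"
  shows "inj_on (\<lambda>v. nbhd G v \<inter> C) C \<longleftrightarrow> \<not> has_open_twins (G \<restriction> C)"
proof -
  have "\<not> u \<rightarrow>\<^bsub>G \<restriction> C\<^esub> v"
    if "u \<in> C" "v \<in> C" "nbhd (G \<restriction> C) u = nbhd (G \<restriction> C) v" for u v
    using that not_self_in_nbhd[OF assms, of v] nbhd_induce_subgraph[of _ C G]
    by (auto simp: nbhd_def set_eq_iff)
  then have "has_open_twins (G \<restriction> C) \<longleftrightarrow>
      (\<exists>u\<in>C. \<exists>v\<in>C. u \<noteq> v \<and> nbhd (G \<restriction> C) u = nbhd (G \<restriction> C) v)"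
    unfolding has_open_twins_def open_twins_def induce_subgraph_verts by blast
  also have "\<dots> \<longleftrightarrow> \<not> inj_on (\<lambda>v. nbhd G v \<inter> C) C"
    by (auto simp: inj_on_def nbhd_induce_subgraph)
  finally show ?thesis by blast
qed

lemma has_isolated_vertex_induce_iff:
  "has_isolated_vertex (G \<restriction> C) \<longleftrightarrow> {} \<in> (\<lambda>v. nbhd G v \<inter> C) ` C"
  by (auto simp: has_isolated_vertex_def nbhd_induce_subgraph image_iff)

text \<open>Inside \<open>C\<close> the absence of open twins separates, outside \<open>C\<close>
  the bijection does. A vertex of \<open>C\<close> and one outside never share a trace, because the
  outer traces are by definition not realised in \<open>C\<close>.\<close>

lemma GO_inj_on_trace:
  assumes "GO k G C"
  shows "inj_on (\<lambda>v. nbhd G v \<inter> C) (verts G)"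
proof -
  let ?T = "\<lambda>v. nbhd G v \<inter> C"
  have C: "inj_on ?T C"
    using assms inj_on_trace_iff_no_open_twins by (auto simp: GO_def)
  have bij: "bij_betw ?T (verts G - C) {C'. C' \<subseteq> C \<and> C' \<noteq> {} \<and> \<not> (\<exists>u\<in>C. ?T u = C')}"
    using assms by (simp add: GO_def)
  have "inj_on ?T (C \<union> (verts G - C))"
    unfolding inj_on_Un
    using C bij_betw_imp_inj_on[OF bij] bij_betw_imp_surj_on[OF bij] by auto
  moreover have "C \<union> (verts G - C) = verts G" using assms by (auto simp: GO_def)
  ultimately show ?thesis by simp
qed

text \<open>The outer vertices supply exactly the nonempty subsets that \<open>C\<close> misses, so
  only the empty set can be absent, and only a vertex isolated in \<open>G \<restriction> C\<close>
  can supply it.\<close>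

lemma GO_trace_image:
  assumes "GO k G C"
  shows "(\<lambda>v. nbhd G v \<inter> C) ` verts G =
    (if has_isolated_vertex (G \<restriction> C) then Pow C else Pow C - {{}})"
proof -
  let ?T = "\<lambda>v. nbhd G v \<inter> C"
  have "bij_betw ?T (verts G - C) {C'. C' \<subseteq> C \<and> C' \<noteq> {} \<and> \<not> (\<exists>u\<in>C. ?T u = C')}"
    using assms by (simp add: GO_def)
  then have "?T ` (verts G - C) = {C'. C' \<subseteq> C \<and> C' \<noteq> {} \<and> \<not> (\<exists>u\<in>C. ?T u = C')}"
    by (rule bij_betw_imp_surj_on)
  also have "\<dots> = Pow C - {{}} - ?T ` C" by blast
  finally have "?T ` (verts G - C) = Pow C - {{}} - ?T ` C" .
  moreover have "?T ` verts G = ?T ` C \<union> ?T ` (verts G - C)"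
    unfolding image_Un[symmetric] using assms by (simp add: GO_def Un_absorb1)
  moreover have "?T ` C \<subseteq> Pow C" by auto
  ultimately show ?thesis
    unfolding has_isolated_vertex_induce_iff by auto
qed

lemma GO_card_verts:
  assumes "GO k G C"
  shows "card (verts G) = (if has_isolated_vertex (G \<restriction> C) then 2 ^ k else 2 ^ k - 1)"
proof -
  have "finite C" "card C = k"
    using assms finite_verts_graph finite_subset by (auto simp: GO_def)
  moreover have "card (verts G) = card ((\<lambda>v. nbhd G v \<inter> C) ` verts G)"
    by (rule card_image[OF GO_inj_on_trace[OF assms], symmetric])
  ultimately show ?thesis
    unfolding GO_trace_image[OF assms] by (auto simp: card_Pow card_Diff_singleton)
qed

section \<open>Codes of minimum cardinality\<close>

lemma GO_is_code_OD:
  assumes "GO k G C"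
  shows "is_code OD G C"
proof -
  have sub: "C \<subseteq> verts G" using assms by (simp add: GO_def)
  have "closed_nbhd G v \<inter> C \<noteq> {}" if "v \<in> verts G" for v
  proof (cases "v \<in> C")
    \<comment> \<open>The bijection maps outer vertices to nonempty traces; a vertex of
      \<open>C\<close> dominates itself.\<close>
    case False
    have "bij_betw (\<lambda>v. nbhd G v \<inter> C) (verts G - C)
       {C'. C' \<subseteq> C \<and> C' \<noteq> {} \<and> \<not> (\<exists>u\<in>C. nbhd G u \<inter> C = C')}"
      using assms by (simp add: GO_def)
    from bij_betwE[OF this] show ?thesis
      using that False by (auto simp: closed_nbhd_def)
  qed (auto simp: closed_nbhd_def)
  then show ?thesis
    using sub GO_inj_on_trace[OF assms] by (simp add: open_separating_iff_inj_on dominating_def)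
qed

lemma GO_is_code_OTD:
  assumes "GO k G C" "\<not> has_isolated_vertex (G \<restriction> C)"
  shows "is_code OTD G C"
proof -
  have sub: "C \<subseteq> verts G" using assms by (simp add: GO_def)
  have "nbhd G v \<inter> C \<noteq> {}" if "v \<in> verts G" for v
    using GO_trace_image[OF assms(1)] assms(2) that by auto
  then show ?thesis
    using sub GO_inj_on_trace[OF assms(1)]
    by (simp add: open_separating_iff_inj_on total_dominating_def)
qed

text \<open>The bound \<open>2 ^ card D\<close> holds for both kinds of code and already suffices,
  so no case distinction on \<open>X\<close> arises.\<close>

lemma GO_code_card_ge:
  assumes "GO k G C" "k \<ge> 2" "is_code X G D"
  shows "k \<le> card D"
proof (rule ccontr)
  assume "\<not> k \<le> card D"
  then have "(2::nat) ^ card D \<le> 2 ^ (k - 1)" by (intro power_increasing) auto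
  moreover have "card (verts G) \<le> 2 ^ card D"
    using assms by (auto intro: card_verts_le_power finite_verts_graph simp: GO_def)
  \<comment> \<open>Adding 1 covers both possible orders and avoids truncated subtraction.\<close>
  moreover have "2 ^ k \<le> card (verts G) + 1"
    using GO_card_verts[OF assms(1)] by auto
  moreover have "(2::nat) ^ k = 2 * 2 ^ (k - 1)"
    using assms(2) by (cases k) auto
  \<comment> \<open>The previous facts give \<open>2 ^ (k - 1) \<le> 1\<close>, which fails from
    \<open>k = 2\<close> on.\<close>
  moreover have "(2::nat) \<le> 2 ^ (k - 1)"
    using assms(2) power_increasing[of 1 "k - 1" "2::nat"] by simp
  ultimately show False by linarith
qed

lemma GO_is_arg_min:
  assumes "GO k G C" "k \<ge> 2" "is_code X G C"
  shows "is_arg_min card (is_code X G) C"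
  using assms GO_code_card_ge by (auto simp: is_arg_min_def not_less GO_def)

text \<open>An isolated vertex cannot be totally dominated. Conversely, the whole vertex set
  \<open>C\<close> is a code of \<open>G \<restriction> C\<close>, as distinct vertices have
  distinct neighborhoods there.\<close>

lemma GO_admissible_OTD_induce_iff:
  assumes "GO k G C"
  shows "admissible OTD (G \<restriction> C) \<longleftrightarrow> \<not> has_isolated_vertex (G \<restriction> C)"
proof
  assume "admissible OTD (G \<restriction> C)"
  then show "\<not> has_isolated_vertex (G \<restriction> C)"
    by (auto simp: admissible_def total_dominating_def has_isolated_vertex_def)
next
  assume iso: "\<not> has_isolated_vertex (G \<restriction> C)"
  have "inj_on (\<lambda>v. nbhd G v \<inter> C) C"
    using assms inj_on_trace_iff_no_open_twins by (auto simp: GO_def)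
  then have "is_code OTD (G \<restriction> C) C"
    using iso by (auto simp: open_separating_def total_dominating_def nbhd_induce_subgraph
        has_isolated_vertex_def inj_on_def)
  then show "admissible OTD (G \<restriction> C)" by (auto simp: admissible_def)
qed

section \<open>Existence of the graphs \<open>GO\<close>\<close>

text \<open>Taking ordered pairs as arcs rules out parallel arcs, so symmetry and irreflexivity of
  \<open>R\<close> and finiteness of \<open>V\<close> are all that remains for
  \<open>graph\<close>.\<close>

definition graph_of_rel :: "'a set \<Rightarrow> ('a \<Rightarrow> 'a \<Rightarrow> bool) \<Rightarrow> ('a, 'a \<times> 'a) pre_digraph" where
  "graph_of_rel V R = \<lparr>verts = V, arcs = {(u, v). u \<in> V \<and> v \<in> V \<and> R u v}, tail = fst, head = snd\<rparr>"

lemma graph_graph_of_rel: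
  assumes "finite V" "\<And>u v. R u v \<Longrightarrow> R v u" "\<And>v. \<not> R v v"
  shows "graph (graph_of_rel V R)"
proof -
  have "finite {(u, v). u \<in> V \<and> v \<in> V \<and> R u v}"
    by (rule finite_subset[of _ "V \<times> V"]) (use assms(1) in auto)
  then show ?thesis
    by unfold_locales
      (use assms in \<open>auto simp: graph_of_rel_def symmetric_conv arc_to_ends_def\<close>)
qed

lemma nbhd_graph_of_rel: "v \<in> V \<Longrightarrow> nbhd (graph_of_rel V R) v = {u \<in> V. R v u}"
  by (auto simp: nbhd_def graph_of_rel_def arcs_ends_conv image_iff)

text \<open>The vertex outside \<open>{..<k}\<close> with trace \<open>S\<close> is represented by the number \<open>k + set_encode S\<close>.\<close>
lemma GO_extension_exists:
  fixes R :: "nat \<Rightarrow> nat \<Rightarrow> bool"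
  assumes sym: "\<And>u v. R u v \<Longrightarrow> R v u" and irrefl: "\<And>v. \<not> R v v"
    and inj: "inj_on (\<lambda>v. {u \<in> {..<k}. R v u}) {..<k}"
  shows "\<exists>G :: (nat, nat \<times> nat) pre_digraph. GO k G {..<k} \<and>
    (has_isolated_vertex (G \<restriction> {..<k}) \<longleftrightarrow> (\<exists>v<k. \<forall>u<k. \<not> R v u))"
proof -
  let ?C = "{..<k}"
  define U where "U = {S. S \<subseteq> ?C \<and> S \<noteq> {} \<and> \<not> (\<exists>v\<in>?C. {u \<in> ?C. R v u} = S)}"
  define V where "V = ?C \<union> (\<lambda>S. k + set_encode S) ` U"
  \<comment> \<open>\<open>R\<close> governs the edges inside \<open>C\<close>. An outer vertex is
    joined to the members of the set it encodes, and outer vertices are pairwise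
    non-adjacent.\<close>
  define A where "A u v \<longleftrightarrow> u < k \<and> v < k \<and> R u v \<or>
      u < k \<and> k \<le> v \<and> u \<in> set_decode (v - k) \<or>
      v < k \<and> k \<le> u \<and> v \<in> set_decode (u - k)" for u v
  define G where "G = graph_of_rel V A"
  have finU: "finite U" unfolding U_def by (rule finite_subset[of _ "Pow ?C"]) auto
  have G: "graph G"
    unfolding G_def
    by (rule graph_graph_of_rel) (use finU sym irrefl in \<open>auto simp: V_def A_def\<close>)
  have inner: "nbhd G v \<inter> ?C = {u \<in> ?C. R v u}" if "v \<in> ?C" for v
    using that by (auto simp: G_def nbhd_graph_of_rel V_def A_def)
  have outer: "nbhd G (k + set_encode S) \<inter> ?C = S" if "S \<in> U" for S
  proof -
    \<comment> \<open>Finiteness lets \<open>set_decode\<close> invert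
      \<open>set_encode\<close>.\<close>
    have "S \<subseteq> ?C" "finite S" using that finite_subset[of S ?C] by (auto simp: U_def)
    then show ?thesis using that by (auto simp: G_def nbhd_graph_of_rel V_def A_def)
  qed
  have verts: "verts G = V" by (simp add: G_def graph_of_rel_def)
  have diff: "V - ?C = (\<lambda>S. k + set_encode S) ` U" by (auto simp: V_def)
  have "inj_on (\<lambda>v. nbhd G v \<inter> ?C) ?C"
    using inj inner by (subst inj_on_cong[where g = "\<lambda>v. {u \<in> ?C. R v u}"]) auto
  then have "\<not> has_open_twins (G \<restriction> ?C)"
    using inj_on_trace_iff_no_open_twins[OF G] by simp
  moreover have "bij_betw (\<lambda>v. nbhd G v \<inter> ?C) (V - ?C) U"
    unfolding diff by (rule bij_betw_byWitness[where f' = "\<lambda>S. k + set_encode S"]) (auto simp: outer)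
  moreover have "{S. S \<subseteq> ?C \<and> S \<noteq> {} \<and> \<not> (\<exists>u\<in>?C. nbhd G u \<inter> ?C = S)} = U"
    using inner by (auto simp: U_def)
  ultimately have "GO k G ?C"
    using G by (simp add: GO_def verts V_def)
  moreover have "has_isolated_vertex (G \<restriction> ?C) \<longleftrightarrow> (\<exists>v<k. \<forall>u<k. \<not> R v u)"
    by (auto simp: has_isolated_vertex_def nbhd_induce_subgraph inner)
  ultimately show ?thesis by blast
qed

text \<open>On \<open>C\<close> take a complete graph for \<open>OTD\<close>, and a complete graph plus an isolated vertex for \<open>OD\<close>.\<close>
lemma GO_exists:
  assumes "k \<ge> 3"
  shows "\<exists>(G :: (nat, nat \<times> nat) pre_digraph) C.
    GO k G C \<and> (has_isolated_vertex (G \<restriction> C) \<longleftrightarrow> X = OD)"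
proof -
  \<comment> \<open>For \<open>OD\<close>, vertex 0 is the isolated one.\<close>
  define R where "R u v \<longleftrightarrow> u \<noteq> v \<and> (X = OD \<longrightarrow> u \<noteq> 0 \<and> v \<noteq> 0)" for u v :: nat
  have "u = v" if "u < k" "v < k" and eq: "{w \<in> {..<k}. R u w} = {w \<in> {..<k}. R v w}" for u v
  proof (rule ccontr)
    assume "u \<noteq> v"
    have "R u w \<longleftrightarrow> R v w" if "w < k" for w using eq that by blast
    \<comment> \<open>Two vertices of the complete part are told apart by \<open>u\<close> or
      \<open>v\<close> itself. The isolated vertex 0 is told apart from the other one by a neighbor
      of the latter among 1 and 2, which exist since \<open>k \<ge> 3\<close>.\<close>
    from this[of 1] this[of 2] this[of u] this[of v] show False
      using \<open>u \<noteq> v\<close> that assms unfolding R_def by (cases X; cases "u = 0"; cases "v = 0") auto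
  qed
  then have inj: "inj_on (\<lambda>v. {u \<in> {..<k}. R v u}) {..<k}" by (auto intro!: inj_onI)
  have iso: "(\<exists>v<k. \<forall>u<k. \<not> R v u) \<longleftrightarrow> X = OD"
  proof
    assume "\<exists>v<k. \<forall>u<k. \<not> R v u"
    then obtain v where "\<forall>u<k. \<not> R v u" by blast
    \<comment> \<open>In the complete graph a vertex is non-adjacent only to itself, and
      \<open>v\<close> cannot be both 0 and 1.\<close>
    then have "\<not> R v 0" "\<not> R v 1" using assms by auto
    then show "X = OD" by (auto simp: R_def)
  qed (use assms in \<open>auto simp: R_def intro!: exI[of _ 0]\<close>)
  have sym: "R v u" if "R u v" for u v using that by (auto simp: R_def)
  have irrefl: "\<not> R v v" for v by (simp add: R_def)
  obtain G :: "(nat, nat \<times> nat) pre_digraph" where "GO k G {..<k}"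
    "has_isolated_vertex (G \<restriction> {..<k}) \<longleftrightarrow> (\<exists>v<k. \<forall>u<k. \<not> R v u)"
    using GO_extension_exists[of R k, OF sym irrefl inj] by blast
  then show ?thesis using iso by blast
qed

section \<open>Comparison of densities\<close>

text \<open>Both densities have numerator \<open>k\<close>, so the larger order gives the smaller
  density, and the order of \<open>G\<close> equals the upper bound valid for
  \<open>H\<close>.\<close>

lemma GO_code_density_le:
  fixes G :: "('a, 'b) pre_digraph" and H :: "('c, 'd) pre_digraph"
  assumes "GO k G C" "k > 0" "has_isolated_vertex (G \<restriction> C) \<longleftrightarrow> X = OD" "code_number X G = k"
    and H: "graph H" "admissible X H" "code_number X H = k"
  shows "code_density X G \<le> code_density X H"
proof -
  have fin: "finite (verts H)" using H finite_verts_graph by blast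
  obtain D where D: "is_code X H D" "card D = k"
    using code_number_attained[OF fin H(2)] H(3) by metis
  have "card (verts H) \<le> card (verts G)"
    using card_verts_le_power[OF fin D(1)] card_verts_le_power_minus_1[OF fin] D GO_card_verts[OF assms(1)]
      assms(3) by (cases X) auto
  \<comment> \<open>Division by 0 yields 0, so monotonicity of the quotient needs positive
    orders.\<close>
  moreover have "card (verts H) > 0"
    using card_mono[OF fin is_code_subset_verts[OF D(1)]] D(2) assms(2) by simp
  ultimately show ?thesis
    unfolding code_density_def assms(4) H(3) by (intro divide_left_mono) auto
qed

text \<open>The existence clause keeps the claim that the minimum is attained from being vacuous.
  Its witness lives on \<open>nat\<close>, because an arbitrary type \<open>'a\<close> may have too
  few elements.\<close>

theorem theorem3:
  fixes k :: nat
  assumes "k \<ge> 3"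
  shows
    "(\<forall>(G :: ('a,'b) pre_digraph) C. GO k G C \<longrightarrow>
        is_arg_min card (is_code OD G) C \<and>
        (\<not> has_isolated_vertex (G \<restriction> C) \<longleftrightarrow> admissible OTD (G \<restriction> C)) \<and>
        (\<not> has_isolated_vertex (G \<restriction> C) \<longrightarrow> is_arg_min card (is_code OTD G) C)) \<and>
     (\<forall>X.
        (\<exists>(G :: (nat, nat \<times> nat) pre_digraph) C.
           GO k G C \<and> (has_isolated_vertex (G \<restriction> C) \<longleftrightarrow> X = OD)) \<and>
        (\<forall>(G :: ('a,'b) pre_digraph) C.
           GO k G C \<and> (has_isolated_vertex (G \<restriction> C) \<longleftrightarrow> X = OD) \<longrightarrow>
             admissible X G \<and> code_number X G = k \<and>
             (\<forall>H :: ('c,'d) pre_digraph.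
                graph H \<and> admissible X H \<and> code_number X H = k \<longrightarrow>
                code_density X G \<le> code_density X H)))"
proof (intro conjI allI impI; (elim conjE)?)
  fix G :: "('a,'b) pre_digraph" and C
  assume GO: "GO k G C"
  have k: "k \<ge> 2" using assms by simp
  show "is_arg_min card (is_code OD G) C"
    by (rule GO_is_arg_min[OF GO k GO_is_code_OD[OF GO]])
  show "\<not> has_isolated_vertex (G \<restriction> C) \<longleftrightarrow> admissible OTD (G \<restriction> C)"
    using GO_admissible_OTD_induce_iff[OF GO] by blast
  show "is_arg_min card (is_code OTD G) C" if "\<not> has_isolated_vertex (G \<restriction> C)"
    by (rule GO_is_arg_min[OF GO k GO_is_code_OTD[OF GO that]])
next
  fix X
  show "\<exists>(G :: (nat, nat \<times> nat) pre_digraph) C.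
      GO k G C \<and> (has_isolated_vertex (G \<restriction> C) \<longleftrightarrow> X = OD)"
    using GO_exists[OF assms] .
next
  fix X and G :: "('a,'b) pre_digraph" and C
  assume GO: "GO k G C" and iso: "has_isolated_vertex (G \<restriction> C) \<longleftrightarrow> X = OD"
  have code: "is_code X G C"
    using GO_is_code_OD[OF GO] GO_is_code_OTD[OF GO] iso by (cases X) auto
  then show "admissible X G" by (auto simp: admissible_def)
  have "is_arg_min card (is_code X G) C"
    using GO_is_arg_min[OF GO _ code] assms by simp
  then show num: "code_number X G = k"
    using GO code_number_eqI finite_verts_graph by (auto simp: GO_def)
  fix H :: "('c,'d) pre_digraph"
  assume "graph H" "admissible X H" "code_number X H = k"
  then show "code_density X G \<le> code_density X H"
    using GO_code_density_le[OF GO _ iso num] assms by simp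
qed

end
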